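(* Let $\mu>0$ and let $\mathcal P$ be the Fourier multiplier operator on $2\pi$-periodic functions with symbol $\mathcal P(k)=\dfrac{\tanh(\mu k)}{\mu k}$ for $k\neq 0$ and $\mathcal P(0)=1$. Let $q$ be a real-valued $2\pi$-periodic function with $q_x\in L^2([0,2\pi])$, and suppose the function $\mathcal P q_x$ is not identically zero. Define the operator $B$ on $L^2([0,2\pi])$ by \[ Bf=(\mathcal P q_x)\,\mathcal P^2\partial_x^2\big((\mathcal P q_x)\,f\big), \] where $(\mathcal P q_x)\,g$ denotes pointwise multiplication of $g$ by the function $\mathcal P q_x$. Then $B$ is not a compact operator on $L^2([0,2\pi])$.
   Context: All functions are real-valued and $2\pi$-periodic on $[0,2\pi]$, with Fourier coefficients $\hat f_k$, $k\in\mathbb Z$. A Fourier multiplier with symbol $m(k)$ acts by $\widehat{(mf)}_k=m(k)\hat f_k$; in particular $\partial_x$ has symbol $ik$, so $\mathcal P^2\partial_x^2$ has symbol $-k^2\mathcal P(k)^2=-\tanh^2(\mu k)/\mu^2$. The expression $\mathcal P q_x$ denotes the function obtained by applying $\mathcal P$ to $q_x=\partial_x q$ (this is the "regularised Boussinesq-Whitham" choice of $\mathcal P$). *)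

theory Defs
  imports "HOL-Analysis.Analysis"
begin

definition L2 :: "(real \<Rightarrow> real) \<Rightarrow> bool" where
  "L2 f \<longleftrightarrow> set_borel_measurable lborel {0..2*pi} f
              \<and> set_integrable lborel {0..2*pi} (\<lambda>x. (f x)^2)"

definition L2norm :: "(real \<Rightarrow> real) \<Rightarrow> real" where
  "L2norm f = sqrt (LINT x:{0..2*pi}|lborel. (f x)^2)"

definition fcoeff :: "(real \<Rightarrow> real) \<Rightarrow> int \<Rightarrow> complex" where
  "fcoeff f k = (LINT x:{0..2*pi}|lborel. complex_of_real (f x) * cis (- (real_of_int k * x)))
                 / complex_of_real (2*pi)"

definition is_multiplier :: "(int \<Rightarrow> complex) \<Rightarrow> (real \<Rightarrow> real) \<Rightarrow> (real \<Rightarrow> real) \<Rightarrow> bool" where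
  "is_multiplier m f g \<longleftrightarrow> L2 g \<and> (\<forall>k. fcoeff g k = m k * fcoeff f k)"

definition mult_op :: "(int \<Rightarrow> complex) \<Rightarrow> (real \<Rightarrow> real) \<Rightarrow> (real \<Rightarrow> real)" where
  "mult_op m f = (SOME g. is_multiplier m f g)"

definition Psym :: "real \<Rightarrow> int \<Rightarrow> complex" where
  "Psym \<mu> k = (if k = 0 then 1 else complex_of_real (tanh (\<mu> * real_of_int k) / (\<mu> * real_of_int k)))"

definition P2D2sym :: "real \<Rightarrow> int \<Rightarrow> complex" where
  "P2D2sym \<mu> k = (\<i> * of_int k)^2 * (Psym \<mu> k)^2"

definition Bop :: "real \<Rightarrow> (real \<Rightarrow> real) \<Rightarrow> (real \<Rightarrow> real) \<Rightarrow> (real \<Rightarrow> real)" where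
  "Bop \<mu> qx f = (let w = mult_op (Psym \<mu>) qx in
                  (\<lambda>x. w x * mult_op (P2D2sym \<mu>) (\<lambda>y. w y * f y) x))"

text \<open>Compact operator on L2([0,2pi]) (sequential characterisation; L2 is complete,
  so Cauchy subsequences are convergent).\<close>
definition compact_L2_op :: "((real \<Rightarrow> real) \<Rightarrow> (real \<Rightarrow> real)) \<Rightarrow> bool" where
  "compact_L2_op T \<longleftrightarrow>
     (\<forall>f :: nat \<Rightarrow> real \<Rightarrow> real. (\<forall>n. L2 (f n)) \<and> (\<exists>C. \<forall>n. L2norm (f n) \<le> C) \<longrightarrow>
        (\<exists>r :: nat \<Rightarrow> nat. strict_mono r \<and>
           (\<forall>e>0. \<exists>N. \<forall>m\<ge>N. \<forall>n\<ge>N. L2norm (\<lambda>x. T (f (r m)) x - T (f (r n)) x) < e)))"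

end

theory Submission
  imports Defs
begin

text \<open>
  The symbol of \<open>P\<^sup>2 \<partial>\<^sub>x\<^sup>2\<close> is \<open>-tanh\<^sup>2(\<mu>k)/\<mu>\<^sup>2 = -1/\<mu>\<^sup>2 + sech\<^sup>2(\<mu>k)/\<mu>\<^sup>2\<close>, so the operator is
  \<open>-1/\<mu>\<^sup>2\<close> times the identity plus a smoothing operator that is bounded from \<open>L\<^sup>1\<close> to \<open>L\<^sup>\<infinity>\<close>.
  Let \<open>w = P q\<^sub>x\<close> and let \<open>A\<close> be a set of positive measure on which \<open>1/M \<le> |w| \<le> M\<close>.
  For disjoint subsets \<open>B\<^sub>n\<close> of \<open>A\<close> of small positive measure, the functions
  \<open>f\<^sub>n = 1\<^bsub>B\<^sub>n\<^esub> / (w |B\<^sub>n|\<^sup>1\<^sup>/\<^sup>2)\<close> are bounded in \<open>L\<^sup>2\<close>. The smoothing part of \<open>w f\<^sub>n\<close> is at most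
  a multiple of \<open>|B\<^sub>n|\<^sup>1\<^sup>/\<^sup>2\<close>, so the images of \<open>f\<^sub>m\<close> and \<open>f\<^sub>n\<close> stay a fixed distance apart,
  already on \<open>B\<^sub>m\<close>.

  Since multipliers are defined by choice from the Fourier coefficients, this needs existence for both
  symbols (absolutely convergent Fourier series) and uniqueness (Stone-Weierstrass on the unit circle
  and inner regularity of Lebesgue measure).
\<close>

subsection \<open>Fourier coefficients on the period interval\<close>

text \<open>Restricting the measure, instead of carrying indicators of [0, 2*pi], makes the
  integration lemmas for finite measures directly applicable.
  \<open>L2_iff_integrable_period\<close>, \<open>L2norm_eq_period\<close> and
  \<open>fcoeff_eq_period\<close> translate the given definitions.\<close>

abbreviation period_measure :: "real measure" ("\<bbbT>") where
  "\<bbbT> \<equiv> restrict_space lborel {0..2 * pi}"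

lemma finite_measure_period: "finite_measure \<bbbT>"
  by (intro finite_measureI) (simp add: space_restrict_space emeasure_restrict_space)

lemma space_period [simp]: "space \<bbbT> = {0..2*pi}"
  by (simp add: space_restrict_space)

lemma borel_measurable_period: "f \<in> borel_measurable borel \<Longrightarrow> f \<in> borel_measurable \<bbbT>"
  by (intro measurable_restrict_space1) simp

lemma cis_linear_measurable [measurable]: "(\<lambda>x. cis (a * x)) \<in> borel_measurable borel"
  by (intro borel_measurable_continuous_onI continuous_intros)

lemma integrable_period_bounded:
  fixes f :: "real \<Rightarrow> 'a::{banach, second_countable_topology}"
  assumes "f \<in> borel_measurable \<bbbT>" "\<And>x. norm (f x) \<le> B"
  shows "integrable \<bbbT> f"
  using assms finite_measure_period
  by (intro finite_measure.integrable_const_bound[of _ _ B]) auto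

lemma L2_iff_integrable_period: "L2 f \<longleftrightarrow> f \<in> borel_measurable \<bbbT> \<and> integrable \<bbbT> (\<lambda>x. (f x)\<^sup>2)"
  by (simp add: L2_def set_borel_measurable_def set_integrable_def integrable_restrict_space
      borel_measurable_restrict_space_iff)

lemma L2norm_eq_period: "L2norm f = sqrt (\<integral>x. (f x)\<^sup>2 \<partial>\<bbbT>)"
  by (simp add: L2norm_def set_lebesgue_integral_def integral_restrict_space)

lemma fcoeff_eq_period:
  "fcoeff f k = (\<integral>x. complex_of_real (f x) * cis (- (real_of_int k * x)) \<partial>\<bbbT>) / complex_of_real (2*pi)"
  by (simp add: fcoeff_def set_lebesgue_integral_def integral_restrict_space)

lemma integrable_mult_cis:
  assumes "integrable \<bbbT> (f :: real \<Rightarrow> complex)"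
  shows "integrable \<bbbT> (\<lambda>x. f x * cis (a * x))"
  by (rule Bochner_Integration.integrable_bound[OF assms])
    (use assms in \<open>auto simp: norm_mult intro!: borel_measurable_times borel_measurable_period[OF cis_linear_measurable]\<close>)

lemma integrable_of_real_mult_cis:
  assumes "integrable \<bbbT> (f :: real \<Rightarrow> real)"
  shows "integrable \<bbbT> (\<lambda>x. of_real (f x) * cis (- (a * x)))"
  using integrable_mult_cis[of "\<lambda>x. of_real (f x)" "- a"] assms by simp

text \<open>The measure is finite, so the pointwise bound |y| \<le> 1 + y^2 can replace
  Cauchy-Schwarz.\<close>

lemma L2_imp_integrable: 
  assumes "L2 f" shows "integrable \<bbbT> f"
proof (rule Bochner_Integration.integrable_bound)
  show "integrable \<bbbT> (\<lambda>x. 1 + (f x)\<^sup>2)"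
    using assms finite_measure.integrable_const[OF finite_measure_period]
    by (intro Bochner_Integration.integrable_add) (auto simp: L2_iff_integrable_period)
  have "\<bar>y\<bar> \<le> 1 + y\<^sup>2" for y :: real
    using zero_le_power2[of "\<bar>y\<bar> - 1"] unfolding power2_diff by simp
  then show "AE x in \<bbbT>. norm (f x) \<le> norm (1 + (f x)\<^sup>2)" by (intro AE_I2) (simp add: add_increasing)
qed (use assms in \<open>simp add: L2_iff_integrable_period\<close>)

lemma L2_bounded:
  assumes "f \<in> borel_measurable \<bbbT>" "\<And>x. \<bar>f x\<bar> \<le> B"
  shows "L2 f"
  unfolding L2_iff_integrable_period
proof
  have "(f x)\<^sup>2 \<le> B\<^sup>2" for x
    using power_mono[OF assms(2)[of x], of 2] by simp
  then show "integrable \<bbbT> (\<lambda>x. (f x)\<^sup>2)"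
    using assms(1) by (intro integrable_period_bounded[of _ "B\<^sup>2"]) auto
qed fact

lemma L2_lincomb:
  assumes "L2 f" "L2 g"
  shows "L2 (\<lambda>x. a * f x + b * g x)"
  unfolding L2_iff_integrable_period
proof
  have f: "f \<in> borel_measurable \<bbbT>" "integrable \<bbbT> (\<lambda>x. (f x)\<^sup>2)"
    and g: "g \<in> borel_measurable \<bbbT>" "integrable \<bbbT> (\<lambda>x. (g x)\<^sup>2)"
    using assms by (auto simp: L2_iff_integrable_period)
  show meas: "(\<lambda>x. a * f x + b * g x) \<in> borel_measurable \<bbbT>" using f g by simp
  show "integrable \<bbbT> (\<lambda>x. (a * f x + b * g x)\<^sup>2)"
  proof (rule Bochner_Integration.integrable_bound)
    show "integrable \<bbbT> (\<lambda>x. 2 * a\<^sup>2 * (f x)\<^sup>2 + 2 * b\<^sup>2 * (g x)\<^sup>2)" using f g by simp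
    have "(s + t)\<^sup>2 \<le> 2 * s\<^sup>2 + 2 * t\<^sup>2" for s t :: real
      using zero_le_power2[of "s - t"] by (simp add: power2_eq_square algebra_simps)
    from this[of "a * f x" "b * g x" for x]
    show "AE x in \<bbbT>. norm ((a * f x + b * g x)\<^sup>2) \<le> norm (2 * a\<^sup>2 * (f x)\<^sup>2 + 2 * b\<^sup>2 * (g x)\<^sup>2)"
      by (intro AE_I2) (simp add: power_mult_distrib mult.assoc)
  qed (use meas in simp)
qed

lemma fcoeff_lincomb:
  assumes "integrable \<bbbT> f" "integrable \<bbbT> g"
  shows "fcoeff (\<lambda>x. a * f x + b * g x) k = of_real a * fcoeff f k + of_real b * fcoeff g k"
proof -
  have "(\<integral>x. of_real (a * f x + b * g x) * cis (- (real_of_int k * x)) \<partial>\<bbbT>)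
      = (\<integral>x. of_real a * (of_real (f x) * cis (- (real_of_int k * x)))
           + of_real b * (of_real (g x) * cis (- (real_of_int k * x))) \<partial>\<bbbT>)"
    by (simp add: algebra_simps)
  also have "\<dots> = of_real a * (\<integral>x. of_real (f x) * cis (- (real_of_int k * x)) \<partial>\<bbbT>)
           + of_real b * (\<integral>x. of_real (g x) * cis (- (real_of_int k * x)) \<partial>\<bbbT>)"
    using assms by (subst Bochner_Integration.integral_add) (auto intro!: integrable_of_real_mult_cis)
  finally show ?thesis by (simp add: fcoeff_eq_period add_divide_distrib)
qed

text \<open>Conjugating the integrand flips the sign of k because f is real. This symmetry is what
  allows \<open>fourier_series_exists\<close> to return a real function.\<close>

lemma fcoeff_uminus_index: "fcoeff f (- k) = cnj (fcoeff f k)"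
proof -
  have "cnj (\<integral>x. of_real (f x) * cis (- (real_of_int k * x)) \<partial>\<bbbT>)
      = (\<integral>x. of_real (f x) * cis (real_of_int k * x) \<partial>\<bbbT>)"
    by (subst Bochner_Integration.integral_cnj[symmetric]) (simp add: cis_cnj)
  then show ?thesis by (simp add: fcoeff_eq_period)
qed

text \<open>The factor 1/(2*pi) is dropped as harmless. Control by the L1 norm, uniform in k, is
  what makes the smoothing part bounded from L1 to the bounded functions.\<close>

lemma norm_fcoeff_le: "cmod (fcoeff f k) \<le> (\<integral>x. \<bar>f x\<bar> \<partial>\<bbbT>)"
proof -
  have "cmod (\<integral>x. of_real (f x) * cis (- (real_of_int k * x)) \<partial>\<bbbT>) \<le> (\<integral>x. \<bar>f x\<bar> \<partial>\<bbbT>)"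
    by (rule order_trans[OF integral_norm_bound]) (simp add: norm_mult)
  moreover have "\<dots> \<le> (\<integral>x. \<bar>f x\<bar> \<partial>\<bbbT>) * (2 * pi)"
    using pi_gt3 by (simp add: mult_le_cancel_left1 not_less)
  ultimately show ?thesis by (simp add: fcoeff_eq_period norm_divide divide_le_eq)
qed

lemma integral_cis_period:
  "(\<integral>x. cis (real_of_int k * x) \<partial>\<bbbT>) = (if k = 0 then of_real (2 * pi) else 0)"
proof (cases "k = 0")
  case True
  then show ?thesis by (simp add: measure_restrict_space scaleR_conv_of_real)
next
  case False
  have "(\<integral>x. indicator {0..2*pi} x *\<^sub>R cis (real_of_int k * x) \<partial>lborel)
      = cis (real_of_int k * (2*pi)) / (\<i> * of_int k) - cis (real_of_int k * 0) / (\<i> * of_int k)"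
  proof (rule integral_FTC_atLeastAtMost)
    fix x
    have "((\<lambda>x. exp (\<i> * of_int k * of_real x) / (\<i> * of_int k)) has_vector_derivative
        exp (\<i> * of_int k * of_real x)) (at x within {0..2*pi})"
      using False by (auto intro!: derivative_eq_intros has_vector_derivative_real_field)
    then show "((\<lambda>x. cis (real_of_int k * x) / (\<i> * of_int k)) has_vector_derivative
        cis (real_of_int k * x)) (at x within {0..2*pi})"
      by (simp add: cis_conv_exp mult_ac)
  qed (auto intro!: continuous_intros)
  moreover have "cis (real_of_int k * (2*pi)) = 1"
    by (metis cis_multiple_2pi mult.commute Ints_of_int)
  ultimately show ?thesis using False by (simp add: integral_restrict_space)
qed

text \<open>With p the Fourier partial sum over S, expand the nonnegative integral of |f - p|^2. By
  orthogonality the integral of f times the conjugate of p and that of |p|^2 are the same number,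
  2*pi times the sum on the left.\<close>

lemma Bessel_inequality:
  assumes "L2 f" and S: "finite S"
  shows "(\<Sum>k\<in>S. (cmod (fcoeff f k))\<^sup>2) \<le> (\<integral>x. (f x)\<^sup>2 \<partial>\<bbbT>) / (2*pi)"
proof -
  let ?c = "fcoeff f"
  define p where "p x = (\<Sum>k\<in>S. ?c k * cis (real_of_int k * x))" for x
  have f: "integrable \<bbbT> f" "integrable \<bbbT> (\<lambda>x. (f x)\<^sup>2)"
    using L2_imp_integrable[OF assms(1)] assms(1) unfolding L2_iff_integrable_period by blast+
  have c: "(\<integral>x. complex_of_real (f x) * cis (- (real_of_int k * x)) \<partial>\<bbbT>) = 2*pi * ?c k" for k
    by (simp add: fcoeff_eq_period)
  have cisint: "integrable \<bbbT> (\<lambda>x. cis (a * x))" for a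
    by (rule integrable_period_bounded[of _ 1]) (auto intro: borel_measurable_period)
  have fp: "of_real (f x) * cnj (p x) = (\<Sum>k\<in>S. cnj (?c k) * (of_real (f x) * cis (- (real_of_int k * x))))" for x
    by (simp add: p_def cis_cnj sum_distrib_left mult.left_commute)
  have int1: "integrable \<bbbT> (\<lambda>x. of_real (f x) * cnj (p x))"
    unfolding fp using f
    by (intro Bochner_Integration.integrable_sum integrable_mult_right integrable_of_real_mult_cis)
  have "(\<integral>x. of_real (f x) * cnj (p x) \<partial>\<bbbT>)
     = (\<Sum>k\<in>S. \<integral>x. cnj (?c k) * (of_real (f x) * cis (- (real_of_int k * x))) \<partial>\<bbbT>)"
    unfolding fp using f
    by (intro Bochner_Integration.integral_sum integrable_mult_right integrable_of_real_mult_cis)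
  also have "\<dots> = (\<Sum>k\<in>S. cnj (?c k) * (2*pi * ?c k))"
    unfolding c[symmetric] by simp
  also have "\<dots> = of_real (2*pi * (\<Sum>k\<in>S. (cmod (?c k))\<^sup>2))"
    by (simp add: sum_distrib_left complex_norm_square mult_ac del: of_real_power)
  finally have I1: "(\<integral>x. of_real (f x) * cnj (p x) \<partial>\<bbbT>) = of_real (2*pi * (\<Sum>k\<in>S. (cmod (?c k))\<^sup>2))" .
  have cc: "(a * cis (real_of_int j * x)) * (b * cis (- (real_of_int k * x)))
      = (a * b) * cis (real_of_int (j - k) * x)" for a b j k x
  proof -
    have "cis (real_of_int j * x) * cis (- (real_of_int k * x)) = cis (real_of_int (j - k) * x)"
      by (simp add: cis_mult left_diff_distrib)
    then show ?thesis by (metis mult.assoc mult.left_commute)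
  qed
  have "p x * cnj (p x) = (\<Sum>j\<in>S. \<Sum>k\<in>S. (?c j * cis (real_of_int j * x)) * (cnj (?c k) * cis (- (real_of_int k * x))))" for x
    unfolding p_def cnj_sum sum_product complex_cnj_mult cis_cnj ..
  then have pp: "p x * cnj (p x) = (\<Sum>j\<in>S. \<Sum>k\<in>S. (?c j * cnj (?c k)) * cis (real_of_int (j - k) * x))" for x
    by (simp only: cc)
  have int2: "integrable \<bbbT> (\<lambda>x. p x * cnj (p x))"
    unfolding pp by (intro Bochner_Integration.integrable_sum integrable_mult_right cisint)
  have "(\<integral>x. p x * cnj (p x) \<partial>\<bbbT>)
     = (\<Sum>j\<in>S. \<integral>x. (\<Sum>k\<in>S. (?c j * cnj (?c k)) * cis (real_of_int (j - k) * x)) \<partial>\<bbbT>)"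
    unfolding pp
    by (intro Bochner_Integration.integral_sum Bochner_Integration.integrable_sum integrable_mult_right cisint)
  also have "\<dots> = (\<Sum>j\<in>S. \<Sum>k\<in>S. \<integral>x. (?c j * cnj (?c k)) * cis (real_of_int (j - k) * x) \<partial>\<bbbT>)"
    by (intro sum.cong refl Bochner_Integration.integral_sum integrable_mult_right cisint)
  also have "\<dots> = (\<Sum>j\<in>S. \<Sum>k\<in>S. if j = k then of_real (2*pi*(cmod (?c j))\<^sup>2) else 0)"
    unfolding integral_mult_right_zero integral_cis_period
    by (intro sum.cong) (auto simp: complex_norm_square simp del: of_real_power)
  also have "\<dots> = of_real (2*pi * (\<Sum>k\<in>S. (cmod (?c k))\<^sup>2))"
    using S by (simp add: sum_distrib_left)
  finally have I2: "(\<integral>x. p x * cnj (p x) \<partial>\<bbbT>) = of_real (2*pi * (\<Sum>k\<in>S. (cmod (?c k))\<^sup>2))" .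
  have sq: "(cmod (of_real a - z))\<^sup>2 = a\<^sup>2 - 2 * Re (of_real a * cnj z) + Re (z * cnj z)" for a z
    unfolding cmod_power2 by (simp add: power2_eq_square algebra_simps)
  have "0 \<le> (\<integral>x. (cmod (of_real (f x) - p x))\<^sup>2 \<partial>\<bbbT>)"
    by (rule Bochner_Integration.integral_nonneg) simp
  also have "\<dots> = (\<integral>x. (f x)\<^sup>2 - 2 * Re (of_real (f x) * cnj (p x)) + Re (p x * cnj (p x)) \<partial>\<bbbT>)"
    unfolding sq ..
  also have "\<dots> = (\<integral>x. (f x)\<^sup>2 - 2 * Re (of_real (f x) * cnj (p x)) \<partial>\<bbbT>) + (\<integral>x. Re (p x * cnj (p x)) \<partial>\<bbbT>)"
    by (intro Bochner_Integration.integral_add Bochner_Integration.integrable_diff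
        integrable_mult_right integrable_Re f int1 int2)
  also have "\<dots> = (\<integral>x. (f x)\<^sup>2 \<partial>\<bbbT>) - (\<integral>x. 2 * Re (of_real (f x) * cnj (p x)) \<partial>\<bbbT>) + (\<integral>x. Re (p x * cnj (p x)) \<partial>\<bbbT>)"
    by (subst Bochner_Integration.integral_diff)
       (intro integrable_mult_right integrable_Re f int1 refl)+
  also have "\<dots> = (\<integral>x. (f x)\<^sup>2 \<partial>\<bbbT>) - 2 * Re (\<integral>x. of_real (f x) * cnj (p x) \<partial>\<bbbT>) + Re (\<integral>x. p x * cnj (p x) \<partial>\<bbbT>)"
    unfolding integral_mult_right_zero integral_Re[OF int1] integral_Re[OF int2] ..
  finally show ?thesis unfolding I1 I2 by (simp add: field_simps)
qed

text \<open>Needed for the symbol \<open>Psym\<close>, whose decay like 1/k is not summable by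
  itself. Indices k \<ge> 0 suffice, since negative ones are conjugates.\<close>

lemma summable_fcoeff_square:
  assumes "L2 f"
  shows "summable (\<lambda>n. (cmod (fcoeff f (int n)))\<^sup>2)"
proof (rule bounded_imp_summable)
  fix n
  have "(\<Sum>k\<le>n. (cmod (fcoeff f (int k)))\<^sup>2) = (\<Sum>k\<in>int ` {..n}. (cmod (fcoeff f k))\<^sup>2)"
    by (subst sum.reindex) auto
  also have "\<dots> \<le> (\<integral>x. (f x)\<^sup>2 \<partial>\<bbbT>) / (2*pi)"
    by (intro Bessel_inequality assms) simp
  finally show "(\<Sum>k\<le>n. (cmod (fcoeff f (int k)))\<^sup>2) \<le> (\<integral>x. (f x)\<^sup>2 \<partial>\<bbbT>) / (2*pi)" .
qed simp

subsection \<open>Absolutely convergent Fourier series\<close>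

text \<open>Grouping the frequencies n and -n gives a real series over the naturals. Its uniform
  majorant yields the sup bound and also justifies computing the coefficients term by term.\<close>

lemma fourier_series_exists:
  assumes summable: "summable (\<lambda>n. cmod (c (int n)))" and sym: "\<And>k. c (- k) = cnj (c k)"
  obtains g where "g \<in> borel_measurable borel" "\<And>k. fcoeff g k = c k"
    "\<And>x. \<bar>g x\<bar> \<le> 2 * (\<Sum>n. cmod (c (int n)))"
proof -
  define u where "u n x = (if n = 0 then 1 else 2) * Re (c (int n) * cis (real n * x))" for n x
  have Re_le: "\<bar>Re (z * cis y)\<bar> \<le> cmod z" for z y
    using abs_Re_le_cmod[of "z * cis y"] by (simp add: norm_mult)
  have u_bound: "\<bar>u n x\<bar> \<le> 2 * cmod (c (int n))" for n x
    using Re_le[of "c (int n)" "real n * x"] by (auto simp: u_def)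
  have summable2: "summable (\<lambda>n. 2 * cmod (c (int n)))"
    using summable by (rule summable_mult)
  have summable_u: "summable (\<lambda>n. \<bar>u n x\<bar>)" for x
    by (rule summable_comparison_test'[OF summable2]) (use u_bound in auto)
  have u_meas: "u n \<in> borel_measurable borel" for n
    unfolding u_def by measurable
  define g where "g x = (\<Sum>n. u n x)" for x
  have c_int: "(\<integral>x. of_real (u n x) * cis (- (real_of_int k * x)) \<partial>\<bbbT>)
      = (if n = nat \<bar>k\<bar> then 2 * pi * c k else 0)" for n k
  proof -
    have cisint: "integrable \<bbbT> (\<lambda>x. cis (a * x))" for a
      by (rule integrable_period_bounded[of _ 1]) (auto intro: borel_measurable_period)
    \<comment> \<open>For n = 0 the two exponentials of a conjugate pair coincide, so each carries
      weight 1/2; this matches the factor 1 in place of 2 in \<open>u\<close>.\<close>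
    define a where "a = (if n = 0 then 1/2 else 1 :: complex)"
    have "of_real (u n x) * cis (- (real_of_int k * x))
      = a * c (int n) * cis (real_of_int (int n - k) * x)
        + a * c (- int n) * cis (real_of_int (- int n - k) * x)" for x
    proof -
      have "of_real (2 * Re (c (int n) * cis (real n * x)))
          = c (int n) * cis (real n * x) + c (- int n) * cis (- (real n * x))"
        by (metis complex_add_cnj complex_cnj_mult cis_cnj sym)
      then have "of_real (u n x) = a * (c (int n) * cis (real n * x) + c (- int n) * cis (- (real n * x)))"
        by (auto simp: u_def a_def)
      then have "of_real (u n x) * cis (- (real_of_int k * x))
        = a * c (int n) * (cis (real n * x) * cis (- (real_of_int k * x)))
         + a * c (- int n) * (cis (- (real n * x)) * cis (- (real_of_int k * x)))"
        by (simp add: ring_distribs mult.assoc)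
      then show ?thesis unfolding cis_mult by (simp add: ring_distribs)
    qed
    then have "(\<integral>x. of_real (u n x) * cis (- (real_of_int k * x)) \<partial>\<bbbT>)
      = a * c (int n) * (\<integral>x. cis (real_of_int (int n - k) * x) \<partial>\<bbbT>)
        + a * c (- int n) * (\<integral>x. cis (real_of_int (- int n - k) * x) \<partial>\<bbbT>)"
      using cisint by (simp only: Bochner_Integration.integral_add integrable_mult_right integral_mult_right_zero)
    then show ?thesis
      unfolding integral_cis_period by (auto simp: a_def)
  qed
  have norm_le: "norm (complex_of_real (u n x) * cis (- (real_of_int k * x))) \<le> 2 * cmod (c (int n))" for n x k
    using u_bound by (simp add: norm_mult)
  have meas: "(\<lambda>x. complex_of_real (u n x) * cis (- (real_of_int k * x))) \<in> borel_measurable \<bbbT>" for n k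
    using u_meas[of n] cis_linear_measurable[of "- real_of_int k"] by (intro borel_measurable_period) simp
  have int: "integrable \<bbbT> (\<lambda>x. complex_of_real (u n x) * cis (- (real_of_int k * x)))" for n k
    by (rule integrable_period_bounded[OF meas norm_le])
  have "fcoeff g k = c k" for k
  proof -
    have "(\<integral>x. of_real (g x) * cis (- (real_of_int k * x)) \<partial>\<bbbT>)
       = (\<integral>x. (\<Sum>n. of_real (u n x) * cis (- (real_of_int k * x))) \<partial>\<bbbT>)"
    proof (intro Bochner_Integration.integral_cong refl)
      fix x
      have "(\<lambda>n. u n x) sums g x"
        unfolding g_def using summable_rabs_cancel[OF summable_u] by (rule summable_sums)
      then have "(\<lambda>n. complex_of_real (u n x) * cis (- (real_of_int k * x))) sums
          (of_real (g x) * cis (- (real_of_int k * x)))"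
        by (intro sums_mult2 sums_of_real)
      then show "of_real (g x) * cis (- (real_of_int k * x))
          = (\<Sum>n. of_real (u n x) * cis (- (real_of_int k * x)))"
        by (rule sums_unique)
    qed
    \<comment> \<open>Sum and integral may be exchanged because the integrals of the norms are at
      most the length of the period times 2 |c n|, which is summable.\<close>
    also have "\<dots> = (\<Sum>n. \<integral>x. of_real (u n x) * cis (- (real_of_int k * x)) \<partial>\<bbbT>)"
    proof (rule integral_suminf[OF int])
      show "AE x in \<bbbT>. summable (\<lambda>n. norm (complex_of_real (u n x) * cis (- (real_of_int k * x))))"
        using summable_u by (simp add: norm_mult)
      have "(\<integral>x. norm (complex_of_real (u n x) * cis (- (real_of_int k * x))) \<partial>\<bbbT>)
        \<le> (\<integral>x. 2 * cmod (c (int n)) \<partial>\<bbbT>)" for n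
        using finite_measure.integrable_const[OF finite_measure_period]
        by (intro integral_mono norm_le integrable_norm int)
      then show "summable (\<lambda>n. \<integral>x. norm (complex_of_real (u n x) * cis (- (real_of_int k * x))) \<partial>\<bbbT>)"
        by (intro summable_comparison_test'[OF summable_mult[OF summable2, of "measure \<bbbT> {0..2*pi}"], of 0])
           (simp add: Bochner_Integration.integral_nonneg mult.assoc)
    qed
    also have "\<dots> = 2 * pi * c k"
      unfolding c_int by (subst suminf_finite[of "{nat \<bar>k\<bar>}"]) auto
    finally show ?thesis by (simp add: fcoeff_eq_period)
  qed
  moreover have "\<bar>g x\<bar> \<le> 2 * (\<Sum>n. cmod (c (int n)))" for x
  proof -
    have "\<bar>g x\<bar> \<le> (\<Sum>n. \<bar>u n x\<bar>)" unfolding g_def by (rule summable_rabs[OF summable_u])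
    also have "\<dots> \<le> (\<Sum>n. 2 * cmod (c (int n)))" by (rule suminf_le[OF u_bound summable_u summable2])
    also have "\<dots> = 2 * (\<Sum>n. cmod (c (int n)))" by (rule suminf_mult[OF summable])
    finally show ?thesis .
  qed
  moreover have "g \<in> borel_measurable borel"
    unfolding g_def by (intro borel_measurable_suminf u_meas)
  ultimately show ?thesis using that by blast
qed

subsection \<open>Uniqueness of Fourier coefficients\<close>

text \<open>Complex values and all integer frequencies are allowed so that the property survives
  multiplication of h by an exponential, which merely shifts k.\<close>

definition annihilates_exponentials :: "(real \<Rightarrow> complex) \<Rightarrow> bool" where
  "annihilates_exponentials h \<longleftrightarrow>
     integrable \<bbbT> h \<and> (\<forall>k::int. (\<integral>x. h x * cis (real_of_int k * x) \<partial>\<bbbT>) = 0)"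

lemma annihilates_exponentials_add:
  assumes "annihilates_exponentials h" "annihilates_exponentials h'"
  shows "annihilates_exponentials (\<lambda>x. a * h x + b * h' x)"
proof -
  have "(\<integral>x. (a * h x + b * h' x) * cis (real_of_int k * x) \<partial>\<bbbT>)
    = (\<integral>x. a * (h x * cis (real_of_int k * x)) + b * (h' x * cis (real_of_int k * x)) \<partial>\<bbbT>)" for k
    by (simp add: algebra_simps)
  also have "\<dots> k = a * (\<integral>x. h x * cis (real_of_int k * x) \<partial>\<bbbT>) + b * (\<integral>x. h' x * cis (real_of_int k * x) \<partial>\<bbbT>)" for k
    using assms unfolding annihilates_exponentials_def
    by (subst Bochner_Integration.integral_add) (auto intro!: integrable_mult_cis)
  finally show ?thesis using assms by (simp add: annihilates_exponentials_def)
qed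

lemma annihilates_exponentials_cis:
  assumes "annihilates_exponentials h"
  shows "annihilates_exponentials (\<lambda>x. h x * cis (real_of_int j * x))"
proof -
  have "h x * cis (real_of_int j * x) * cis (real_of_int k * x) = h x * cis (real_of_int (j + k) * x)" for k x
    by (simp add: mult.assoc cis_mult ring_distribs)
  then show ?thesis
    using assms by (simp only: annihilates_exponentials_def integrable_mult_cis simp_thms)
qed

text \<open>Quantifying over \<open>h\<close> makes the set of admissible \<open>p\<close> trivially closed under products.\<close>

lemma annihilates_exponentials_polynomial:
  assumes "real_polynomial_function (p :: complex \<Rightarrow> real)" "annihilates_exponentials h"
  shows "annihilates_exponentials (\<lambda>x. h x * of_real (p (cis x)))"
  using assms
proof (induction arbitrary: h)
  case (linear p)
  \<comment> \<open>A real-linear p takes the value p(1) cos x + p(i) sin x at \<open>cis x\<close>.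
    By Euler's formulas, \<alpha> and \<beta> are the coefficients of its exponentials with
    frequencies 1 and -1.\<close>
  define \<alpha> \<beta> where "\<alpha> = (of_real (p 1) - \<i> * of_real (p \<i>)) / 2"
    and "\<beta> = (of_real (p 1) + \<i> * of_real (p \<i>)) / 2"
  have "of_real (p (cis x)) = \<alpha> * cis (real_of_int 1 * x) + \<beta> * cis (real_of_int (-1) * x)" for x
  proof -
    have "p (cis x) = p (cos x *\<^sub>R 1 + sin x *\<^sub>R \<i>)"
      by (rule arg_cong[of _ _ p]) (simp add: complex_eq_iff)
    also have "\<dots> = cos x * p 1 + sin x * p \<i>"
      using linear(1) by (simp add: bounded_linear.axioms(1) linear_add linear_scale bounded_linear.linear)
    finally show ?thesis by (simp add: \<alpha>_def \<beta>_def complex_eq_iff field_simps)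
  qed
  then have "(\<lambda>x. h x * of_real (p (cis x)))
     = (\<lambda>x. \<alpha> * (h x * cis (real_of_int 1 * x)) + \<beta> * (h x * cis (real_of_int (-1) * x)))"
    by (simp add: fun_eq_iff ring_distribs mult_ac)
  then show ?case
    by (simp only: annihilates_exponentials_add annihilates_exponentials_cis linear(2))
next
  case (const c)
  show ?case
    using annihilates_exponentials_add[OF const const, of "of_real c" 0] by (simp add: mult.commute)
next
  case (add f g)
  show ?case
    using annihilates_exponentials_add[OF add.IH(1)[OF add.prems] add.IH(2)[OF add.prems], of 1 1]
    by (simp add: ring_distribs)
next
  case (mult f g)
  show ?case
    using mult.IH(2)[OF mult.IH(1)[OF mult.prems]] by (simp add: mult.assoc)
qed

lemma continuous_cis_compose:
  fixes \<phi> :: "complex \<Rightarrow> real"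
  assumes "continuous_on (sphere 0 1) \<phi>"
  shows "(\<lambda>x. \<phi> (cis x)) \<in> borel_measurable borel"
  by (intro borel_measurable_continuous_onI continuous_on_compose2[OF assms])
     (auto intro!: continuous_intros)

lemma integrable_mult_bounded:
  fixes f g :: "real \<Rightarrow> real"
  assumes "integrable \<bbbT> f" "g \<in> borel_measurable borel" "\<And>x. \<bar>g x\<bar> \<le> B"
  shows "integrable \<bbbT> (\<lambda>x. f x * g x)"
proof (rule Bochner_Integration.integrable_bound)
  show "integrable \<bbbT> (\<lambda>x. B * f x)" using assms by simp
  have "\<bar>f x * g x\<bar> \<le> \<bar>B * f x\<bar>" for x
    using mult_left_mono[OF order_trans[OF assms(3)[of x] abs_ge_self], of "\<bar>f x\<bar>"]
    by (simp add: abs_mult mult.commute)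
  then show "AE x in \<bbbT>. norm (f x * g x) \<le> norm (B * f x)" by simp
qed (use assms borel_measurable_period[OF assms(2)] in simp)

text \<open>By Stone-Weierstrass, \<phi> is within e of a polynomial on the circle. The polynomial
  integrates to 0 against f, and the error contributes at most e times the L1 norm of f.\<close>

lemma integral_continuous_circle_eq_0:
  assumes f: "integrable \<bbbT> f" and zero: "\<And>k. fcoeff f k = 0"
    and cont: "continuous_on (sphere 0 1) (\<phi> :: complex \<Rightarrow> real)"
  shows "(\<integral>x. f x * \<phi> (cis x) \<partial>\<bbbT>) = 0"
proof -
  have "\<bar>\<integral>x. f x * \<phi> (cis x) \<partial>\<bbbT>\<bar> \<le> e * (\<integral>x. \<bar>f x\<bar> \<partial>\<bbbT>)" if "e > 0" for e
  proof -
    obtain p where p: "real_polynomial_function p" "\<And>z. z \<in> sphere 0 1 \<Longrightarrow> \<bar>\<phi> z - p z\<bar> < e"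
      using Stone_Weierstrass_real_polynomial_function[OF compact_sphere cont \<open>e > 0\<close>] by blast
    have "annihilates_exponentials (\<lambda>x. of_real (f x))"
      unfolding annihilates_exponentials_def
    proof (intro conjI allI)
      fix k show "(\<integral>x. of_real (f x) * cis (real_of_int k * x) \<partial>\<bbbT>) = 0"
        \<comment> \<open>The sign changes because \<open>fcoeff\<close> integrates against the
          exponential with frequency -k.\<close>
        using zero[of "- k"] by (simp add: fcoeff_eq_period)
    qed (use f in simp)
    from annihilates_exponentials_polynomial[OF p(1) this]
    have ann: "integrable \<bbbT> (\<lambda>x. complex_of_real (f x * p (cis x)))"
      "(\<integral>x. complex_of_real (f x * p (cis x)) * cis (real_of_int 0 * x) \<partial>\<bbbT>) = 0"
      unfolding annihilates_exponentials_def of_real_mult by blast+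
    then have pz: "integrable \<bbbT> (\<lambda>x. f x * p (cis x))" "(\<integral>x. f x * p (cis x) \<partial>\<bbbT>) = 0"
      by (simp_all only: complex_of_real_integrable_eq of_int_0 mult_zero_left cis_zero mult_1_right
          integral_complex_of_real of_real_eq_0_iff)
    have pc: "continuous_on (sphere 0 1) (\<lambda>z. \<phi> z - p z)"
      using p(1) cont by (intro continuous_intros) (auto intro: continuous_on_polymonial_function simp: real_polynomial_function_eq)
    have d: "\<bar>\<phi> (cis x) - p (cis x)\<bar> \<le> e" for x
      using p(2)[of "cis x"] by simp
    have int: "integrable \<bbbT> (\<lambda>x. f x * (\<phi> (cis x) - p (cis x)))"
      by (rule integrable_mult_bounded[OF f continuous_cis_compose[OF pc] d])
    have "(\<integral>x. f x * \<phi> (cis x) \<partial>\<bbbT>) = (\<integral>x. f x * (\<phi> (cis x) - p (cis x)) + f x * p (cis x) \<partial>\<bbbT>)"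
      by (simp add: algebra_simps)
    also have "\<dots> = (\<integral>x. f x * (\<phi> (cis x) - p (cis x)) \<partial>\<bbbT>)"
      using int pz by simp
    also have "\<bar>\<dots>\<bar> \<le> (\<integral>x. \<bar>f x * (\<phi> (cis x) - p (cis x))\<bar> \<partial>\<bbbT>)"
      by (rule integral_abs_bound)
    also have "\<dots> \<le> (\<integral>x. e * \<bar>f x\<bar> \<partial>\<bbbT>)"
    proof (rule integral_mono)
      show "\<bar>f x * (\<phi> (cis x) - p (cis x))\<bar> \<le> e * \<bar>f x\<bar>" for x
        using mult_right_mono[OF d[of x], of "\<bar>f x\<bar>"] by (simp add: abs_mult mult.commute)
      show "integrable \<bbbT> (\<lambda>x. \<bar>f x * (\<phi> (cis x) - p (cis x))\<bar>)"
        using int by (rule integrable_abs)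
    qed (use f in simp)
    finally show ?thesis by simp
  qed
  from this[of "inverse (real (Suc n))" for n]
  have "\<bar>\<integral>x. f x * \<phi> (cis x) \<partial>\<bbbT>\<bar> \<le> inverse (real (Suc n)) * (\<integral>x. \<bar>f x\<bar> \<partial>\<bbbT>)" for n by simp
  moreover have "(\<lambda>n. inverse (real (Suc n)) * (\<integral>x. \<bar>f x\<bar> \<partial>\<bbbT>)) \<longlonglongrightarrow> 0 * (\<integral>x. \<bar>f x\<bar> \<partial>\<bbbT>)"
    by (intro tendsto_intros LIMSEQ_inverse_real_of_nat)
  ultimately have "\<bar>\<integral>x. f x * \<phi> (cis x) \<partial>\<bbbT>\<bar> \<le> 0"
    using LIMSEQ_le_const[of _ 0 "\<bar>\<integral>x. f x * \<phi> (cis x) \<partial>\<bbbT>\<bar>"] by auto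
  then show ?thesis by simp
qed

text \<open>The indicator of the compact image of D on the circle is a pointwise limit of continuous
  tent functions, so dominated convergence with majorant |f| extends the continuous case.\<close>

lemma integral_compact_eq_0:
  assumes f: "integrable \<bbbT> f" and zero: "\<And>k. fcoeff f k = 0"
    and D: "compact D" "D \<subseteq> {0..2*pi}"
  shows "(\<integral>x. f x * indicator D x \<partial>\<bbbT>) = 0"
\<comment> \<open>The empty set is separated because \<open>infdist z {}\<close> is 0, which would
  make every tent function constantly 1.\<close>
proof (cases "D = {}")
  case False
  define C where "C = cis ` D"
  have C: "closed C" "C \<noteq> {}"
    using D False compact_continuous_image[OF continuous_on_cis[OF continuous_on_id] D(1)]
    by (auto simp: C_def compact_imp_closed)
  define \<phi> where "\<phi> n z = max 0 (1 - real n * infdist z C)" for n z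
  have \<phi>_cont: "continuous_on S (\<phi> n)" for n S
    unfolding \<phi>_def by (intro continuous_intros)
  have \<phi>_bound: "\<bar>\<phi> n z\<bar> \<le> 1" for n z
    using infdist_nonneg[of z C] by (auto simp: \<phi>_def)
  have \<phi>_lim: "(\<lambda>n. \<phi> n z) \<longlonglongrightarrow> indicator C z" for z
  proof (cases "z \<in> C")
    case True
    then show ?thesis by (simp add: \<phi>_def)
  next
    case False
    then have pos: "infdist z C > 0"
      using C in_closed_iff_infdist_zero[of C z] infdist_nonneg[of z C] by fastforce
    obtain N where N: "real N * infdist z C > 1"
      using reals_Archimedean3[OF pos] by blast
    have "\<phi> n z = 0" if "n \<ge> N" for n
    proof -
      have "real N * infdist z C \<le> real n * infdist z C"
        using that pos by (intro mult_right_mono) auto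
      then show ?thesis using N by (simp add: \<phi>_def)
    qed
    then have "eventually (\<lambda>n. \<phi> n z = 0) sequentially" by (auto simp: eventually_sequentially)
    then show ?thesis using False by (simp add: tendsto_eventually)
  qed
  \<comment> \<open>\<open>cis\<close> glues 0 to 2*pi, so C may pick up an endpoint outside D. Away
    from these two points a collision \<open>cis x = cis y\<close> forces x = y.\<close>
  have indC: "AE x in \<bbbT>. indicator C (cis x) = (indicator D x :: real)"
  proof -
    have "AE x in lborel. x \<noteq> 0 \<and> x \<noteq> 2*pi"
      using AE_lborel_singleton[of "0::real"] AE_lborel_singleton[of "2*pi"] by eventually_elim simp
    then show ?thesis
      unfolding AE_restrict_space_iff[of "{0..2*pi}" lborel, simplified]
    proof eventually_elim
      case (elim x)
      have "x = y" if "x \<in> {0..2*pi}" "y \<in> D" "cis x = cis y" for y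
      proof -
        have "sin x = sin y \<and> cos x = cos y" using that(3) by (simp add: complex_eq_iff)
        then obtain n :: int where n: "x = y + 2 * pi * n" using sin_cos_eq_iff by blast
        have "0 < x" "x < 2*pi" "0 \<le> y" "y \<le> 2*pi" using elim that D(2) by auto
        with n have "pi * real_of_int n < pi * 1" "pi * (- 1) < pi * real_of_int n" by linarith+
        then have "real_of_int n < 1" "- 1 < real_of_int n"
          by (simp_all only: mult_less_cancel_left_pos pi_gt_zero)
        then have "n = 0" by linarith
        then show ?thesis using n by simp
      qed
      then show ?case by (auto simp: indicator_def C_def)
    qed
  qed
  have "(\<lambda>n. \<integral>x. f x * \<phi> n (cis x) \<partial>\<bbbT>) \<longlonglongrightarrow> (\<integral>x. f x * indicator D x \<partial>\<bbbT>)"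
  proof (rule integral_dominated_convergence[where w = "\<lambda>x. \<bar>f x\<bar>"])
    show "(\<lambda>x. f x * indicator D x) \<in> borel_measurable \<bbbT>"
      using f D by (intro borel_measurable_times borel_measurable_period[of "indicator D"])
        (auto simp: compact_imp_closed)
    show "(\<lambda>x. f x * \<phi> n (cis x)) \<in> borel_measurable \<bbbT>" for n
      using f borel_measurable_period[OF continuous_cis_compose[OF \<phi>_cont]]
      by (intro borel_measurable_times) auto
    show "AE x in \<bbbT>. (\<lambda>n. f x * \<phi> n (cis x)) \<longlonglongrightarrow> f x * indicator D x"
      using indC by eventually_elim (metis \<phi>_lim tendsto_mult_left)
    show "AE x in \<bbbT>. norm (f x * \<phi> n (cis x)) \<le> \<bar>f x\<bar>" for n
      using \<phi>_bound by (auto simp: abs_mult intro!: mult_left_le)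
  qed (use f in simp)
  moreover have "(\<integral>x. f x * \<phi> n (cis x) \<partial>\<bbbT>) = 0" for n
    by (rule integral_continuous_circle_eq_0[OF f zero \<phi>_cont])
  ultimately show ?thesis by (simp add: LIMSEQ_const_iff)
qed simp

text \<open>If f were positive on a set of positive measure, that set would contain a compact subset
  T of positive measure. The integral of f over T is 0, although f is positive there.\<close>

lemma AE_nonpos_if_fcoeff_0:
  assumes f: "integrable \<bbbT> f" and zero: "\<And>k. fcoeff f k = 0"
  shows "AE x in \<bbbT>. f x \<le> 0"
proof -
  define P where "P = {x \<in> {0..2*pi}. f x > 0}"
  have "{x \<in> space \<bbbT>. f x > 0} \<in> sets \<bbbT>"
    using f by measurable
  then have P: "P \<in> sets lborel"
    by (auto simp: P_def sets_restrict_space_iff)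
  have "emeasure lborel P = 0"
  proof (rule ccontr)
    assume "emeasure lborel P \<noteq> 0"
    moreover have "emeasure lborel P \<le> emeasure lborel {0..2*pi}"
      by (intro emeasure_mono) (auto simp: P_def)
    then have fin: "emeasure lborel P < \<infinity>"
      by (simp add: le_less_trans[OF _ ennreal_less_top])
    then have eq: "emeasure lborel P = ennreal (measure lborel P)"
      by (intro emeasure_eq_ennreal_measure) auto
    ultimately have pos: "measure lborel P > 0"
      by (metis ennreal_0 measure_nonneg order_le_less)
    \<comment> \<open>The tolerance is the measure of P itself: what is removed is then strictly
      smaller than P, so T cannot be null.\<close>
    obtain T where T: "closed T" "T \<subseteq> P" "emeasure lebesgue (P - T) < ennreal (measure lborel P)"
      using sets_lebesgue_inner_closed[of P "measure lborel P"] P pos by (metis sets_completionI_sets)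
    have "T \<subseteq> {0..2*pi}" using T(2) by (auto simp: P_def)
    then have "compact T"
      using T(1) bounded_subset[OF bounded_closed_interval] by (simp add: compact_eq_bounded_closed)
    have T': "T \<in> sets lborel" using T by simp
    have "(\<integral>x. f x * indicator T x \<partial>\<bbbT>) = 0"
      by (rule integral_compact_eq_0[OF f zero]) fact+
    moreover have "integrable \<bbbT> (\<lambda>x. f x * indicator T x)"
    proof (rule integrable_mult_bounded[OF f, of _ 1])
      show "indicator T \<in> borel_measurable borel" using T by simp
    qed (simp add: indicator_def)
    moreover have "AE x in \<bbbT>. 0 \<le> f x * indicator T x"
      using T(2) by (intro AE_I2) (auto simp: indicator_def P_def)
    ultimately have "AE x in \<bbbT>. f x * indicator T x = 0"
      using integral_nonneg_eq_0_iff_AE by blast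
    then have "AE x in lborel. x \<notin> T"
      unfolding AE_restrict_space_iff[of "{0..2*pi}" lborel, simplified]
      by eventually_elim (use T(2) in \<open>auto simp: P_def indicator_def split: if_splits\<close>)
    then have "emeasure lborel T = 0"
      using T' by (simp add: AE_iff_measurable[of T])
    moreover have "emeasure lborel P \<le> emeasure lborel T + emeasure lborel (P - T)"
      using emeasure_subadditive[of T lborel "P - T"] P T' T(2) by (simp add: Un_absorb1)
    moreover have "emeasure lborel (P - T) < emeasure lborel P"
      using T(3) P T' eq by (simp add: sets.Diff)
    ultimately show False by simp
  qed
  then have "AE x in lborel. x \<notin> P"
    using P by (simp add: AE_iff_measurable[of P])
  then show ?thesis
    unfolding AE_restrict_space_iff[of "{0..2*pi}" lborel, simplified]
    by eventually_elim (auto simp: P_def)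
qed

lemma fcoeff_unique:
  assumes "integrable \<bbbT> f" "integrable \<bbbT> g" "\<And>k. fcoeff f k = fcoeff g k"
  shows "AE x in \<bbbT>. f x = g x"
proof -
  have le: "AE x in \<bbbT>. u x \<le> v x"
    if "integrable \<bbbT> u" "integrable \<bbbT> v" "\<And>k. fcoeff u k = fcoeff v k" for u v
  proof -
    have "fcoeff (\<lambda>x. 1 * u x + (- 1) * v x) k = 0" for k
      unfolding fcoeff_lincomb[OF that(1,2)] that(3) by simp
    then have "AE x in \<bbbT>. u x - v x \<le> 0"
      using that(1,2) by (intro AE_nonpos_if_fcoeff_0) simp_all
    then show ?thesis by simp
  qed
  have "AE x in \<bbbT>. f x \<le> g x" "AE x in \<bbbT>. g x \<le> f x"
    using assms by (simp_all add: le)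
  then show ?thesis by eventually_elim simp
qed

subsection \<open>The multipliers\<close>

lemma is_multiplier_mult_op: "is_multiplier m f g \<Longrightarrow> is_multiplier m f (mult_op m f)"
  unfolding mult_op_def using someI[of "is_multiplier m f" g] by simp

text \<open>The choice in \<open>mult_op\<close> fixes no particular representative; uniqueness of
  coefficients shows that any explicit multiplier image describes it almost everywhere.\<close>

lemma mult_op_AE_eq:
  assumes "is_multiplier m f g"
  shows "AE x in \<bbbT>. mult_op m f x = g x"
  using assms is_multiplier_mult_op[OF assms]
  by (intro fcoeff_unique L2_imp_integrable) (auto simp: is_multiplier_def)

text \<open>The symbol is at most 1/(\<mu> n) and the coefficients of f are square summable, so a b
  \<le> a^2 + b^2 makes the product absolutely summable.\<close>

lemma Psym_multiplier_exists:
  assumes "\<mu> > 0" "L2 f"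
  obtains g where "is_multiplier (Psym \<mu>) f g"
proof -
  define c where "c k = Psym \<mu> k * fcoeff f k" for k
  have c_le: "cmod (c (int n)) \<le> (1/\<mu>)\<^sup>2 * inverse (real n ^ 2) + (cmod (fcoeff f (int n)))\<^sup>2" if "n \<ge> 1" for n
  proof -
    have ab: "a * b \<le> a\<^sup>2 + b\<^sup>2" for a b :: real
      using sum_squares_bound[of a b] zero_le_power2[of "a + b"] zero_le_power2[of "a - b"]
      unfolding power2_sum power2_diff by linarith
    have "\<bar>tanh (\<mu> * real n)\<bar> \<le> 1"
      using tanh_real_bounds[of "\<mu> * real n"] by auto
    then have "cmod (Psym \<mu> (int n)) \<le> 1 / (\<mu> * real n)"
      using that assms by (simp add: Psym_def norm_divide norm_mult divide_right_mono flip: of_real_mult of_real_divide)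
    then have "cmod (c (int n)) \<le> 1 / (\<mu> * real n) * cmod (fcoeff f (int n))"
      unfolding c_def norm_mult by (rule mult_right_mono) simp
    also have "\<dots> \<le> (1 / (\<mu> * real n))\<^sup>2 + (cmod (fcoeff f (int n)))\<^sup>2"
      by (rule ab)
    finally show ?thesis by (simp add: field_simps)
  qed
  have "summable (\<lambda>n. (1/\<mu>)\<^sup>2 * inverse (real n ^ 2) + (cmod (fcoeff f (int n)))\<^sup>2)"
    by (intro summable_add summable_mult summable_fcoeff_square assms inverse_power_summable) simp
  then have "summable (\<lambda>n. cmod (c (int n)))"
    \<comment> \<open>The comparison starts at 1, since the majorant for the symbol breaks down at
      frequency 0, where the symbol is 1.\<close>
    by (rule summable_comparison_test'[where N = 1]) (use c_le in simp)
  moreover have "c (- k) = cnj (c k)" for k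
    by (simp add: c_def fcoeff_uminus_index Psym_def)
  ultimately obtain g where g: "g \<in> borel_measurable borel" "\<And>k. fcoeff g k = c k"
    "\<And>x. \<bar>g x\<bar> \<le> 2 * (\<Sum>n. cmod (c (int n)))"
    using fourier_series_exists by blast
  have "L2 g"
    by (rule L2_bounded[OF borel_measurable_period[OF g(1)] g(3)])
  then have "is_multiplier (Psym \<mu>) f g"
    using g(2) by (simp add: is_multiplier_def c_def)
  then show ?thesis by (rule that)
qed

text \<open>Splits the symbol into a constant and a rapidly decaying remainder. Frequency 0 fits
  too: \<open>tanh 0 = 0\<close>, so the two summands cancel.\<close>

lemma P2D2sym_eq:
  assumes "\<mu> > 0"
  shows "P2D2sym \<mu> k = of_real (- (1/\<mu>\<^sup>2) + (1 - (tanh (\<mu> * real_of_int k))\<^sup>2) / \<mu>\<^sup>2)"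
proof (cases "k = 0")
  case False
  have "P2D2sym \<mu> k = of_real (- ((real_of_int k)\<^sup>2 * (tanh (\<mu> * real_of_int k) / (\<mu> * real_of_int k))\<^sup>2))"
    using False by (simp add: P2D2sym_def Psym_def power_mult_distrib)
  also have "- ((real_of_int k)\<^sup>2 * (tanh (\<mu> * real_of_int k) / (\<mu> * real_of_int k))\<^sup>2)
     = - (1/\<mu>\<^sup>2) + (1 - (tanh (\<mu> * real_of_int k))\<^sup>2) / \<mu>\<^sup>2"
    using assms False by (simp add: power_divide power_mult_distrib field_simps)
  finally show ?thesis .
qed (simp add: P2D2sym_def)

text \<open>The left side is 1/cosh^2, and cosh x \<ge> exp x / 2. Along x = \<mu> n this gives a
  convergent geometric majorant.\<close>

lemma one_minus_tanh_square_le: "1 - (tanh x)\<^sup>2 \<le> 4 * exp (- (2 * x))" for x :: real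
proof -
  have "exp x / 2 \<le> cosh x" by (simp add: cosh_def)
  then have "(exp x / 2)\<^sup>2 \<le> (cosh x)\<^sup>2" by (intro power_mono) auto
  then have "1 / (cosh x)\<^sup>2 \<le> 1 / (exp x / 2)\<^sup>2" by (intro divide_left_mono) auto
  moreover have "1 - (tanh x)\<^sup>2 = 1 / (cosh x)\<^sup>2"
    using hyperbolic_pythagoras[of x] diff_divide_distrib[of "(cosh x)\<^sup>2" "(sinh x)\<^sup>2" "(cosh x)\<^sup>2"]
    by (simp add: tanh_def power_divide)
  moreover have "1 / (exp x / 2)\<^sup>2 = 4 * exp (- (2 * x))"
    by (simp add: power_divide exp_minus exp_double inverse_eq_divide)
  ultimately show ?thesis by simp
qed

text \<open>The remainder symbol s is summable and every coefficient of g is bounded by its L1 norm,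
  so the remainder is an absolutely convergent Fourier series. The constant depends on \<mu> but not
  on g.\<close>

lemma P2D2_multiplier_bound:
  assumes "\<mu> > 0"
  obtains C where "C \<ge> 0"
    "\<And>g. L2 g \<Longrightarrow> is_multiplier (P2D2sym \<mu>) g (mult_op (P2D2sym \<mu>) g) \<and>
       (AE x in \<bbbT>. \<bar>mult_op (P2D2sym \<mu>) g x + g x / \<mu>\<^sup>2\<bar> \<le> C * (\<integral>x. \<bar>g x\<bar> \<partial>\<bbbT>))"
proof -
  define s where "s k = (1 - (tanh (\<mu> * real_of_int k))\<^sup>2) / \<mu>\<^sup>2" for k :: int
  have s_nonneg: "s k \<ge> 0" for k
    using tanh_real_bounds[of "\<mu> * real_of_int k"]
    by (auto simp: s_def abs_square_le_1 abs_le_iff intro!: divide_nonneg_nonneg)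
  have "summable (\<lambda>n. 4 / \<mu>\<^sup>2 * exp (- (2 * \<mu>)) ^ n)"
    using assms by (intro summable_mult summable_geometric) simp
  moreover have "norm (s (int n)) \<le> 4 / \<mu>\<^sup>2 * exp (- (2 * \<mu>)) ^ n" for n
  proof -
    have "s (int n) \<le> 4 * exp (- (2 * (\<mu> * real n))) / \<mu>\<^sup>2"
      unfolding s_def of_int_of_nat_eq by (intro divide_right_mono one_minus_tanh_square_le) simp
    then show ?thesis
      using s_nonneg by (simp add: mult_ac flip: exp_of_nat_mult)
  qed
  ultimately have summable_s: "summable (\<lambda>n. s (int n))"
    by (rule summable_comparison_test'[where N = 0])
  \<comment> \<open>The factor 2 is the one in the sup bound of
    \<open>fourier_series_exists\<close>.\<close>
  define C where "C = 2 * (\<Sum>n. s (int n))"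
  show ?thesis
  proof (rule that[of C])
    show "C \<ge> 0" using s_nonneg by (simp add: C_def suminf_nonneg summable_s)
    fix g assume g: "L2 g"
    define c where "c k = of_real (s k) * fcoeff g k" for k
    let ?N = "\<integral>x. \<bar>g x\<bar> \<partial>\<bbbT>"
    have c_le: "cmod (c (int n)) \<le> s (int n) * ?N" for n
      using s_nonneg[of "int n"] norm_fcoeff_le[of g "int n"]
      by (simp add: c_def norm_mult mult_left_mono)
    then have summable_c: "summable (\<lambda>n. cmod (c (int n)))"
      by (intro summable_comparison_test'[OF summable_mult2[OF summable_s]]) auto
    moreover have "c (- k) = cnj (c k)" for k
      by (simp add: c_def s_def fcoeff_uminus_index)
    ultimately obtain G where G: "G \<in> borel_measurable borel" "\<And>k. fcoeff G k = c k"
        "\<And>x. \<bar>G x\<bar> \<le> 2 * (\<Sum>n. cmod (c (int n)))"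
      using fourier_series_exists by blast
    have L2G: "L2 G"
      by (rule L2_bounded[OF borel_measurable_period[OF G(1)] G(3)])
    have G_le: "\<bar>G x\<bar> \<le> C * ?N" for x
    proof -
      have "(\<Sum>n. cmod (c (int n))) \<le> (\<Sum>n. s (int n) * ?N)"
        by (rule suminf_le[OF c_le summable_c summable_mult2[OF summable_s]])
      also have "\<dots> = (\<Sum>n. s (int n)) * ?N"
        by (rule suminf_mult2[OF summable_s, symmetric])
      finally show ?thesis using G(3)[of x] by (simp add: C_def)
    qed
    have mult: "is_multiplier (P2D2sym \<mu>) g (\<lambda>x. - (1/\<mu>\<^sup>2) * g x + 1 * G x)"
      unfolding is_multiplier_def
    proof (intro conjI allI L2_lincomb g L2G)
      fix k
      show "fcoeff (\<lambda>x. - (1/\<mu>\<^sup>2) * g x + 1 * G x) k = P2D2sym \<mu> k * fcoeff g k"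
        unfolding fcoeff_lincomb[OF L2_imp_integrable[OF g] L2_imp_integrable[OF L2G]]
          P2D2sym_eq[OF assms] G(2) c_def s_def of_real_add
        by (simp add: ring_distribs)
    qed
    have "AE x in \<bbbT>. \<bar>mult_op (P2D2sym \<mu>) g x + g x / \<mu>\<^sup>2\<bar> \<le> C * ?N"
      using mult_op_AE_eq[OF mult] by eventually_elim (simp add: G_le)
    then show "is_multiplier (P2D2sym \<mu>) g (mult_op (P2D2sym \<mu>) g) \<and>
       (AE x in \<bbbT>. \<bar>mult_op (P2D2sym \<mu>) g x + g x / \<mu>\<^sup>2\<bar> \<le> C * ?N)"
      using is_multiplier_mult_op[OF mult] by blast
  qed
qed

subsection \<open>Non-compactness\<close>

text \<open>The sets where |w| lies between 1/(n+1) and n+1 exhaust the set where w is nonzero. If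
  all of them were null, so would be their countable union.\<close>

lemma positive_measure_where_bounded_away:
  fixes w :: "real \<Rightarrow> real"
  assumes meas: "w \<in> borel_measurable \<bbbT>" and nonzero: "\<not> (AE x in lborel. x \<in> {0..2*pi} \<longrightarrow> w x = 0)"
  obtains M A where "M > 0" "A \<in> sets lborel" "A \<subseteq> {0..2*pi}" "emeasure lborel A \<noteq> 0"
    "\<And>x. x \<in> A \<Longrightarrow> 1 / M \<le> \<bar>w x\<bar> \<and> \<bar>w x\<bar> \<le> M"
proof -
  define A where "A n = {x \<in> space \<bbbT>. 1 / real (Suc n) \<le> \<bar>w x\<bar> \<and> \<bar>w x\<bar> \<le> real (Suc n)}" for n
  have "A n \<in> sets \<bbbT>" for n
    unfolding A_def using meas by measurable
  then have A: "A n \<in> sets lborel" for n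
    by (simp add: sets_restrict_space_iff)
  have "\<exists>n. emeasure lborel (A n) \<noteq> 0"
  proof (rule ccontr)
    assume "\<nexists>n. emeasure lborel (A n) \<noteq> 0"
    then have "AE x in lborel. x \<notin> A n" for n
      using A by (intro AE_not_in null_setsI) auto
    then have "AE x in lborel. \<forall>n. x \<notin> A n" by (simp add: AE_all_countable)
    then have "AE x in lborel. x \<in> {0..2*pi} \<longrightarrow> w x = 0"
    proof eventually_elim
      case (elim x)
      show ?case
      proof (intro impI, rule ccontr)
        assume x: "x \<in> {0..2*pi}" "w x \<noteq> 0"
        obtain n where n: "real n \<ge> max \<bar>w x\<bar> (1 / \<bar>w x\<bar>)" using real_arch_simple by blast
        then have "1 / \<bar>w x\<bar> \<le> real (Suc n)" "\<bar>w x\<bar> \<le> real (Suc n)" by auto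
        then have "x \<in> A n" using x by (simp add: A_def field_simps)
        then show False using elim by blast
      qed
    qed
    then show False using nonzero by blast
  qed
  then obtain n where n: "emeasure lborel (A n) \<noteq> 0" by blast
  show ?thesis
  proof (rule that[of "real (Suc n)" "A n"])
    show "A n \<subseteq> {0..2*pi}" by (auto simp: A_def)
    show "1 / real (Suc n) \<le> \<bar>w x\<bar> \<and> \<bar>w x\<bar> \<le> real (Suc n)" if "x \<in> A n" for x
      using that unfolding A_def by blast
  qed (use A n in simp_all)
qed

text \<open>The distribution function of A is 1-Lipschitz, so it attains every level between 0 and
  the measure of A. Cutting A at the levels c/2^n gives disjoint slices of measure
  c/2^(n+1).\<close>

lemma disjoint_small_subsets:
  fixes a b \<epsilon> :: real
  assumes A: "A \<in> sets lborel" "A \<subseteq> {a..b}" "emeasure lborel A \<noteq> 0" and "\<epsilon> > 0"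
  shows "\<exists>B :: nat \<Rightarrow> real set. disjoint_family B \<and> (\<forall>n. B n \<in> sets lborel \<and> B n \<subseteq> A \<and>
    0 < measure lborel (B n) \<and> measure lborel (B n) \<le> \<epsilon>)"
proof -
  have fin: "S \<in> fmeasurable lborel" if "S \<in> sets lborel" "S \<subseteq> {a..b}" for S
  proof (rule fmeasurableI2[OF _ that(2,1)])
    show "{a..b} \<in> fmeasurable lborel" by (intro fmeasurableI) (simp_all add: emeasure_lborel_Icc_eq)
  qed
  define \<phi> where "\<phi> t = measure lborel (A \<inter> {..t})" for t
  have "A \<noteq> {}" using A(3) by auto
  then have "a \<le> b" using A(2) by auto
  have \<phi>_diff: "\<phi> t - \<phi> s = measure lborel (A \<inter> {s<..t})" if "s \<le> t" for s t
  proof -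
    have "A \<inter> {..t} = (A \<inter> {..s}) \<union> (A \<inter> {s<..t})" using that by auto
    moreover have "measure lborel ((A \<inter> {..s}) \<union> (A \<inter> {s<..t}))
       = measure lborel (A \<inter> {..s}) + measure lborel (A \<inter> {s<..t})"
      using fin[of "A \<inter> {..s}"] fin[of "A \<inter> {s<..t}"] A(1,2)
      by (intro measure_Union) (auto dest: fmeasurableD2)
    ultimately show ?thesis by (simp add: \<phi>_def)
  qed
  have \<phi>_mono: "\<phi> s \<le> \<phi> t" if "s \<le> t" for s t
    using \<phi>_diff[OF that] measure_nonneg[of lborel "A \<inter> {s<..t}"] by linarith
  have \<phi>_lip: "\<phi> t - \<phi> s \<le> t - s" if "s \<le> t" for s t
  proof -
    have "measure lborel (A \<inter> {s<..t}) \<le> measure lborel {s<..t}"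
      using A(1) that by (intro measure_mono_fmeasurable fmeasurableI) auto
    then show ?thesis using \<phi>_diff[OF that] that by simp
  qed
  have "1-lipschitz_on UNIV \<phi>"
  proof (rule lipschitz_onI)
    fix s t :: real
    show "dist (\<phi> s) (\<phi> t) \<le> 1 * dist s t"
      using \<phi>_mono[of s t] \<phi>_mono[of t s] \<phi>_lip[of s t] \<phi>_lip[of t s]
      by (cases "s \<le> t") (simp_all add: dist_real_def)
  qed simp
  then have cont: "continuous_on UNIV \<phi>" by (rule lipschitz_on_continuous_on)
  have "\<phi> a \<le> measure lborel {a}"
    unfolding \<phi>_def using A(1,2) by (intro measure_mono_fmeasurable fmeasurableI) auto
  then have \<phi>_a: "\<phi> a \<le> 0" by (simp add: measure_def)
  have "A \<inter> {..b} = A" using A by auto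
  then have \<phi>_b: "\<phi> b = measure lborel A" by (simp add: \<phi>_def)
  have "measure lborel A > 0"
    using A(3) emeasure_eq_measure2[OF fin[OF A(1,2)]] by (simp add: zero_less_measure_iff)
  \<comment> \<open>The first bound makes all levels attainable; the second keeps every slice below
    \<epsilon>.\<close>
  define c where "c = min (measure lborel A) \<epsilon>"
  have c: "0 < c" "c \<le> measure lborel A" "c \<le> \<epsilon>"
    using \<open>measure lborel A > 0\<close> \<open>\<epsilon> > 0\<close> by (auto simp: c_def)
  have "\<exists>t. \<phi> t = c / 2 ^ n" for n
  proof -
    have "c / 2 ^ n \<le> c" using c by (simp add: divide_le_eq mult_le_cancel_left1)
    then have "\<exists>t. a \<le> t \<and> t \<le> b \<and> \<phi> t = c / 2 ^ n"
    proof (intro IVT')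
      show "\<phi> a \<le> c / 2 ^ n" using \<phi>_a c by (simp add: order_trans[of _ 0])
    qed (use c \<phi>_b \<open>a \<le> b\<close> continuous_on_subset[OF cont] in auto)
    then show ?thesis by blast
  qed
  then obtain t where t: "\<And>n. \<phi> (t n) = c / 2 ^ n" by metis
  \<comment> \<open>Lower levels are attained further left, by monotonicity of \<phi>. The half-open
    slices below may therefore share a cut point without overlapping.\<close>
  have t_less: "t n \<le> t (Suc m)" if "m < n" for m n
  proof (cases "n = Suc m")
    case False
    then have "c / 2 ^ n < c / 2 ^ Suc m"
      using c that by (intro divide_strict_left_mono power_strict_increasing) auto
    then show ?thesis using \<phi>_mono[of "t (Suc m)" "t n"] unfolding t by linarith
  qed simp
  define B where "B n = A \<inter> {t (Suc n)<..t n}" for n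
  have "t (Suc n) \<le> t n" for n
  proof (rule ccontr)
    assume "\<not> t (Suc n) \<le> t n"
    then have "c / 2 ^ n \<le> c / 2 ^ Suc n" using \<phi>_mono[of "t n" "t (Suc n)"] t by simp
    moreover have "c / 2 ^ Suc n < c / 2 ^ n"
      using c by (intro divide_strict_left_mono power_strict_increasing) auto
    ultimately show False by simp
  qed
  then have mB: "measure lborel (B n) = c / 2 ^ Suc n" for n
    using \<phi>_diff[of "t (Suc n)" "t n"] t by (simp add: B_def)
  show ?thesis
  proof (intro exI[of _ B] conjI allI)
    fix n
    show "measure lborel (B n) \<le> \<epsilon>"
    proof -
      have "c / 2 ^ Suc n \<le> c / 1"
        using c one_le_power[of "2::real" "Suc n"] by (intro divide_left_mono) auto
      then show ?thesis using c by (simp add: mB)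
    qed
    show "disjoint_family B"
      unfolding disjoint_family_on_def
    proof (intro ballI impI)
      fix m n :: nat assume "m \<noteq> n"
      then have "t n \<le> t (Suc m) \<or> t m \<le> t (Suc n)"
        using t_less by (meson nat_neq_iff)
      then show "B m \<inter> B n = {}" by (auto simp: B_def)
    qed
  qed (use A c mB in \<open>auto simp: B_def\<close>)
qed

theorem theorem1:
  fixes \<mu> :: real and q qx :: "real \<Rightarrow> real"
  assumes mu_pos: "\<mu> > 0"
    and q_per: "\<forall>x. q (x + 2*pi) = q x"
    and qx_per: "\<forall>x. qx (x + 2*pi) = qx x"
    and qx_L2: "L2 qx"
    and q_deriv: "\<forall>x\<in>{0..2*pi}. q x = q 0 + (LBINT t=0..x. qx t)"
    and nonzero: "\<not> (AE x in lborel. x \<in> {0..2*pi} \<longrightarrow> mult_op (Psym \<mu>) qx x = 0)"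
  shows "\<not> compact_L2_op (Bop \<mu> qx)"
proof
  assume compact: "compact_L2_op (Bop \<mu> qx)"
  define w where "w = mult_op (Psym \<mu>) qx"
  have "L2 w"
  \<comment> \<open>An explicit multiplier image must exist before anything can be said about the
    choice that defines \<open>w\<close>.\<close>
  proof -
    obtain g where "is_multiplier (Psym \<mu>) qx g" by (rule Psym_multiplier_exists[OF mu_pos qx_L2])
    from is_multiplier_mult_op[OF this] show ?thesis by (simp add: w_def is_multiplier_def)
  qed
  then have w: "w \<in> borel_measurable \<bbbT>" "integrable \<bbbT> (\<lambda>x. (w x)\<^sup>2)"
    by (auto simp: L2_iff_integrable_period)
  obtain M A where M: "M > 0" and A: "A \<in> sets lborel" "A \<subseteq> {0..2*pi}" "emeasure lborel A \<noteq> 0"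
    and wA: "\<And>x. x \<in> A \<Longrightarrow> 1 / M \<le> \<bar>w x\<bar> \<and> \<bar>w x\<bar> \<le> M"
    by (rule positive_measure_where_bounded_away[OF w(1) nonzero[folded w_def]]) (rule that)
  define T where "T = mult_op (P2D2sym \<mu>)"
  obtain C where C: "C \<ge> 0" and T_all: "\<And>g. L2 g \<Longrightarrow> is_multiplier (P2D2sym \<mu>) g (T g) \<and>
      (AE x in \<bbbT>. \<bar>T g x + g x / \<mu>\<^sup>2\<bar> \<le> C * (\<integral>x. \<bar>g x\<bar> \<partial>\<bbbT>))"
    by (rule P2D2_multiplier_bound[OF mu_pos, folded T_def]) (rule that)
  note T = T_all[THEN conjunct1] and T_bound = T_all[THEN conjunct2]
  \<comment> \<open>Chosen so that C * (2 * \<epsilon>) \<le> 1/(2 \<mu>^2), half of the main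
    coefficient 1/\<mu>^2. Using C + 1 avoids dividing by 0 when C = 0.\<close>
  define \<epsilon> where "\<epsilon> = 1 / (C + 1) * (1 / (4 * \<mu>\<^sup>2))"
  have "\<epsilon> > 0" using C mu_pos by (simp add: \<epsilon>_def)
  obtain B :: "nat \<Rightarrow> real set" where disj: "disjoint_family B" and B_all: "\<forall>n. B n \<in> sets lborel \<and> B n \<subseteq> A \<and>
      0 < measure lborel (B n) \<and> measure lborel (B n) \<le> \<epsilon>"
    using disjoint_small_subsets[OF A \<open>\<epsilon> > 0\<close>] by blast
  then have B: "B n \<in> sets lborel" "B n \<subseteq> A" "0 < measure lborel (B n)" "measure lborel (B n) \<le> \<epsilon>" for n
    by blast+
  define b where "b n = measure lborel (B n)" for n
  have b: "0 < b n" "b n \<le> \<epsilon>" for n using B by (auto simp: b_def)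
  have B_meas: "(indicator (B n) :: real \<Rightarrow> real) \<in> borel_measurable \<bbbT>" for n
    using B(1)[of n] by (intro borel_measurable_period) simp
  have B_sub: "B n \<subseteq> {0..2*pi}" for n using A(2) B(2) by blast
  have int_B: "integrable \<bbbT> (indicator (B n) :: real \<Rightarrow> real)" for n
    using B_meas by (rule integrable_period_bounded[of _ 1]) (simp add: indicator_def)
  have integral_B: "(\<integral>x. indicator (B n) x \<partial>\<bbbT>) = b n" for n
    using B_sub[of n] by (simp add: b_def measure_restrict_space Int_absorb2)
  \<comment> \<open>\<open>g n\<close> has L2 norm 1, while its L1 norm is only
    \<open>sqrt (b n)\<close>. Zeros of w off \<open>B n\<close> do no harm to \<open>f n\<close>,
    since the numerator vanishes there.\<close>
  define g where "g n x = indicator (B n) x / sqrt (b n)" for n x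
  define f where "f n x = g n x / w x" for n x
  have g_nonneg: "0 \<le> g n x" for n x using b[of n] by (simp add: g_def)
  have g_le: "\<bar>g n x\<bar> \<le> 1 / sqrt (b n)" for n x using b[of n] by (simp add: g_def indicator_def)
  have L2_g: "L2 (g n)" for n
    by (rule L2_bounded[OF _ g_le]) (use B_meas[of n] in \<open>simp add: g_def\<close>)
  have f_le: "\<bar>f n x\<bar> \<le> M * g n x" for n x
  proof (cases "x \<in> B n")
    case True
    then have w_ge: "1 / M \<le> \<bar>w x\<bar>" using wA B(2) by blast
    moreover have "0 < 1 / M" using M by simp
    ultimately have "g n x / \<bar>w x\<bar> \<le> g n x / (1 / M)"
      using M g_nonneg[of n x] by (intro divide_left_mono mult_pos_pos) linarith+
    then show ?thesis using g_nonneg[of n x] by (simp add: f_def mult.commute)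
  qed (simp add: f_def g_def)
  have L2_f: "L2 (f n)" for n
  proof (rule L2_bounded)
    show "f n \<in> borel_measurable \<bbbT>"
      using B_meas[of n] w(1) by (simp add: f_def[abs_def] g_def)
    show "\<bar>f n x\<bar> \<le> M * (1 / sqrt (b n))" for x
      using f_le[of n x] g_le[of n x] M by (meson abs_le_D1 mult_left_mono order.trans less_imp_le)
  qed
  have g_sq: "(g n x)\<^sup>2 = indicator (B n) x / b n" for n x
    using b[of n] by (simp add: g_def power_divide indicator_def)
  have "L2norm (f n) \<le> M" for n
  proof -
    have "(\<integral>x. (f n x)\<^sup>2 \<partial>\<bbbT>) \<le> (\<integral>x. M\<^sup>2 / b n * indicator (B n) x \<partial>\<bbbT>)"
    proof (rule integral_mono)
      show "(f n x)\<^sup>2 \<le> M\<^sup>2 / b n * indicator (B n) x" for x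
        using power_mono[OF f_le[of n x], of 2] by (simp add: power_mult_distrib g_sq)
    qed (use L2_f int_B in \<open>auto simp: L2_iff_integrable_period\<close>)
    also have "\<dots> = M\<^sup>2"
      unfolding integral_mult_right_zero integral_B using b[of n] by simp
    finally show ?thesis
      using M by (simp add: L2norm_eq_period real_le_lsqrt)
  qed
  then have "(\<forall>n. L2 (f n)) \<and> (\<exists>C. \<forall>n. L2norm (f n) \<le> C)" using L2_f by blast
  from compact[unfolded compact_L2_op_def, rule_format, OF this]
  obtain r :: "nat \<Rightarrow> nat" where r: "strict_mono r" and
    cauchy: "\<forall>e>0. \<exists>N. \<forall>m\<ge>N. \<forall>n\<ge>N.
      L2norm (\<lambda>x. Bop \<mu> qx (f (r m)) x - Bop \<mu> qx (f (r n)) x) < e"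
    by blast
  \<comment> \<open>An equality of functions at every point, so that it can be rewritten inside the
    argument of \<open>mult_op\<close>.\<close>
  have wf: "(\<lambda>y. w y * f n y) = g n" for n
  proof
    fix x show "w x * f n x = g n x"
    proof (cases "x \<in> B n")
      case True
      then have "w x \<noteq> 0" using wA[of x] B(2)[of n] M by fastforce
      then show ?thesis by (simp add: f_def)
    qed (simp add: f_def g_def)
  qed
  have Bop_f: "Bop \<mu> qx (f n) = (\<lambda>x. w x * T (g n) x)" for n
    unfolding Bop_def Let_def w_def[symmetric] T_def[symmetric] wf ..
  have T_g: "AE x in \<bbbT>. \<bar>T (g n) x + g n x / \<mu>\<^sup>2\<bar> \<le> C * sqrt (b n)" for n
  proof -
    have "(\<integral>x. \<bar>g n x\<bar> \<partial>\<bbbT>) = (\<integral>x. indicator (B n) x / sqrt (b n) \<partial>\<bbbT>)"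
      unfolding abs_of_nonneg[OF g_nonneg] unfolding g_def ..
    also have "\<dots> = b n / sqrt (b n)"
      unfolding integral_divide_zero integral_B ..
    also have "\<dots> = sqrt (b n)" using b[of n] by (simp add: real_div_sqrt)
    finally show ?thesis using T_bound[OF L2_g[of n]] by simp
  qed
  \<comment> \<open>The factor 1/M is the lower bound of |w| on A, and 1/(2 \<mu>^2) is the half of
    the main coefficient that survives the smoothing errors.\<close>
  define d where "d = 1 / (2 * \<mu>\<^sup>2 * M)"
  have "d > 0" using mu_pos M by (simp add: d_def)
  (* On B m only g m is nonzero; it has size 1 / sqrt (b m) there, while the smoothing parts are O(sqrt \<epsilon>). *)
  have separated: "d \<le> L2norm (\<lambda>x. Bop \<mu> qx (f m) x - Bop \<mu> qx (f n) x)" if "m \<noteq> n" for m n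
  proof -
    define F where "F x = Bop \<mu> qx (f m) x - Bop \<mu> qx (f n) x" for x
    have F: "F x = w x * (T (g m) x - T (g n) x)" for x
      by (simp add: F_def Bop_f right_diff_distrib)
    have T_meas: "T (g k) \<in> borel_measurable \<bbbT>" for k
      using T[OF L2_g[of k]] by (simp add: is_multiplier_def L2_iff_integrable_period)
    \<comment> \<open>K bounds the difference of the two images almost everywhere. Together with
      integrability of w^2 it makes F^2 integrable, which the comparison of integrals below
      requires, as w need not be bounded off A.\<close>
    define K where "K = C * sqrt (b m) + 1 / sqrt (b m) / \<mu>\<^sup>2 + (C * sqrt (b n) + 1 / sqrt (b n) / \<mu>\<^sup>2)"
    have T_le: "AE x in \<bbbT>. \<bar>T (g k) x\<bar> \<le> C * sqrt (b k) + 1 / sqrt (b k) / \<mu>\<^sup>2" for k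
      using T_g[of k]
    proof eventually_elim
      case (elim x)
      have "\<bar>g k x / \<mu>\<^sup>2\<bar> \<le> 1 / sqrt (b k) / \<mu>\<^sup>2"
        using divide_right_mono[OF g_le[of k x], of "\<mu>\<^sup>2"] by simp
      then show ?case using elim by linarith
    qed
    have F_int: "integrable \<bbbT> (\<lambda>x. (F x)\<^sup>2)"
    proof (rule Bochner_Integration.integrable_bound)
      show "integrable \<bbbT> (\<lambda>x. K\<^sup>2 * (w x)\<^sup>2)" using w by simp
      show "(\<lambda>x. (F x)\<^sup>2) \<in> borel_measurable \<bbbT>" unfolding F using w T_meas by simp
      show "AE x in \<bbbT>. norm ((F x)\<^sup>2) \<le> norm (K\<^sup>2 * (w x)\<^sup>2)"
        using T_le[of m] T_le[of n]
      proof eventually_elim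
        case (elim x)
        then have "\<bar>T (g m) x - T (g n) x\<bar> \<le> K" unfolding K_def by linarith
        from power_mono[OF this, of 2] show ?case
          using mult_left_mono[of _ _ "(w x)\<^sup>2"] by (simp add: F power_mult_distrib mult.commute[of "K\<^sup>2"])
      qed
    qed
    \<comment> \<open>The pointwise bound |F| \<ge> d / \<open>sqrt (b m)\<close> on
      \<open>B m\<close> integrates to exactly d^2, whatever the size of \<open>B m\<close>.\<close>
    have "d\<^sup>2 / b m * b m = (\<integral>x. d\<^sup>2 / b m * indicator (B m) x \<partial>\<bbbT>)"
      unfolding integral_mult_right_zero integral_B ..
    also have "\<dots> \<le> (\<integral>x. (F x)\<^sup>2 \<partial>\<bbbT>)"
    proof (rule integral_mono_AE)
      show "AE x in \<bbbT>. d\<^sup>2 / b m * indicator (B m) x \<le> (F x)\<^sup>2"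
        using T_g[of m] T_g[of n]
      proof eventually_elim
        case (elim x)
        show ?case
        proof (cases "x \<in> B m")
          case True
          then have "x \<notin> B n" using disj that by (auto simp: disjoint_family_on_def)
          then have gx: "g m x = 1 / sqrt (b m)" "g n x = 0" using True by (auto simp: g_def)
          define s where "s = sqrt (b m)"
          have s: "s > 0" "s \<le> sqrt \<epsilon>" "sqrt (b n) \<le> sqrt \<epsilon>" using b[of m] b[of n] by (auto simp: s_def)
          \<comment> \<open>The two smoothing errors sum to at most C * (s +
            \<open>sqrt (b n)\<close>). They are compared with the main term of size 1/(s \<mu>^2),
            hence the multiplication by s.\<close>
          have "s * (s + sqrt (b n)) \<le> sqrt \<epsilon> * (sqrt \<epsilon> + sqrt \<epsilon>)"
            using s b[of n] by (intro mult_mono add_mono) auto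
          also have "\<dots> = 2 * \<epsilon>" using \<open>\<epsilon> > 0\<close> by (simp add: distrib_left)
          finally have "C * (s * (s + sqrt (b n))) \<le> C * (2 * \<epsilon>)" using C by (rule mult_left_mono)
          also have "\<dots> = C / (C + 1) * (1 / (2 * \<mu>\<^sup>2))" by (simp add: \<epsilon>_def)
          also have "\<dots> \<le> 1 / (2 * \<mu>\<^sup>2)" using C by (intro mult_left_le_one_le) auto
          finally have "C * (s + sqrt (b n)) \<le> 1 / (2 * \<mu>\<^sup>2) / s"
            unfolding pos_le_divide_eq[OF s(1)] by (simp only: mult_ac)
          \<comment> \<open>One half of the main term absorbs the errors, and the other half remains
            as the lower bound.\<close>
          moreover have "g m x / \<mu>\<^sup>2 = 1 / (2 * \<mu>\<^sup>2) / s + 1 / (2 * \<mu>\<^sup>2) / s"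
            using s mu_pos by (simp add: gx s_def[symmetric] field_simps)
          ultimately have T_ge: "1 / (2 * \<mu>\<^sup>2) / s \<le> \<bar>T (g m) x - T (g n) x\<bar>"
            using elim unfolding gx(2) s_def[symmetric] distrib_left div_0 add_0_right by linarith
          have "1 / M \<le> \<bar>w x\<bar>" using wA True B(2) by blast
          then have "(1 / M) * (1 / (2 * \<mu>\<^sup>2) / s) \<le> \<bar>F x\<bar>"
            unfolding F abs_mult using T_ge M s mu_pos by (intro mult_mono) auto
          moreover have "(1 / M) * (1 / (2 * \<mu>\<^sup>2) / s) = d / s"
            by (simp add: d_def)
          ultimately have "(d / s)\<^sup>2 \<le> \<bar>F x\<bar>\<^sup>2"
            using \<open>d > 0\<close> s by (intro power_mono) auto
          then show ?thesis using True b[of m] by (simp add: power_divide s_def)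
        qed simp
      qed
    qed (use int_B F_int in auto)
    finally have "d\<^sup>2 \<le> (\<integral>x. (F x)\<^sup>2 \<partial>\<bbbT>)" using b[of m] by simp
    then show ?thesis
      unfolding L2norm_eq_period F_def by (rule real_le_rsqrt)
  qed
  obtain N where "\<forall>m\<ge>N. \<forall>n\<ge>N. L2norm (\<lambda>x. Bop \<mu> qx (f (r m)) x - Bop \<mu> qx (f (r n)) x) < d"
    using cauchy \<open>d > 0\<close> by meson
  then have "L2norm (\<lambda>x. Bop \<mu> qx (f (r N)) x - Bop \<mu> qx (f (r (Suc N))) x) < d" by simp
  moreover have "r N \<noteq> r (Suc N)" using strict_mono_eq[OF r] by simp
  ultimately show False using separated by fastforce
qed

end
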